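(* Let $D\in\mathcal{B}(\mathbb{R}^k)$ have non-empty interior and $g\in B_b(S,D)$ be consistent. Suppose that $f\in BC_\mu^{1-}([0,T]\times S\times D,\mathbb{R}^k)$. Then there is at most one $\mu$-admissible solution to (M) on every admissible interval $I$.
   Context: **Spaces.** $S$ is a separable metrizable topological space, $T>0$, $\mu$ is an atomless Borel measure on $[0,T]$, $k\in\mathbb{N}$, $|\cdot|$ is the Euclidean norm. $[0,T]\times S$ carries a pseudometric $d_S$ whose topology is coarser than or equal to the product topology; $\mathcal{B}(I\times S)$ and Borel measurability on $I\times S$ ($I\subset[0,T]$ an interval) refer to $d_S$. A map $u$ on $I\times S$ is consistent if $u(r,x)=u(s,y)$ whenever $d_S((r,x),(s,y))=0$. A map $g$ on $S$ is consistent if $g(x)=g(y)$ whenever $d_S((T,x),(T,y))=0$. $B(S,D)$, $B(I\times S,D)$ are the sets of $D$-valued Borel measurable maps; $B_b$ denotes the bounded ones. **Markov process.** $\mathcal{X}=(X,(\mathcal{F}_t)_{t\in[0,T]},\mathbb{P})$ is a fixed consistent progressive Markov process on a measurable space $(\Omega,\mathcal{F})$ with state space $S$ and Borel measurable transition probabilities: $X:[0,T]\times\Omega\to S$ is a process adapted to the filtration $(\mathcal{F}_t)$, $\mathbb{P}=\{P_{r,x}\mid(r,x)\in[0,T]\times S\}$ is a set of probability measures on $(\Omega,\mathcal{F})$ (expectations $E_{r,x}$), and: (1) for each $(s,y)$, $P_{s,y}$-a.s. $d_S((r,X_r),(r,y))=0$ for all $r\in[0,s]$; (2) $[0,t]\times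 S\to[0,1]$, $(s,x)\mapsto P_{s,x}(X_t\in B)$ is consistent and Borel measurable for all $t\in[0,T]$, $B\in\mathcal{B}(S)$; (3) $P_{r,x}(X_t\in B\mid\mathcal{F}_s)=P_{s,X_s}(X_t\in B)$ $P_{r,x}$-a.s. for all $r\le s\le t$, $x\in S$, $B\in\mathcal{B}(S)$; (4) $X$ is progressively measurable with respect to its natural filtration and its natural backward filtration. **Regularity with respect to $\mu$.** $a\in B([0,T]\times S,\mathbb{R}_+)$ is $\mu$-dominated if there is a $\mu$-integrable $\overline a\in B([0,T],\mathbb{R}_+)$ such that, outside a $\mu$-null set of $s$, $a(s,y)\le\overline a(s)$ for all $y\in S$. A $\mathcal{B}([0,T]\times S)\otimes\mathcal{B}(D)$-measurable $f:[0,T]\times S\times D\to\mathbb{R}^k$ is locally $\mu$-bounded (resp. locally Lipschitz $\mu$-continuous) if each $\hat w\in D$ has a neighborhood $W$ in $\overline D$ and a $\mu$-dominated $\lambda\in B([0,T]\times S,\mathbb{R}_+)$ such that $|f(t,x,w)|\le\lambda(t,x)$ (resp. $|f(t,x,w)-f(t,x,w')|\le\lambda(t,x)|w-w'|$) for all $(t,x)\in[0,T]\times S$ and $w,w'\in W\cap D$. $BC_\mu^{1-}([0,T]\times S\times D,\mathbb{R}^k)$ is the set of all $\mathcal{B}([0,T]\times S)\otimes\mathcal{B}(D)$-measurable maps that are locally $\mu$-bounded and locally Lipschitz $\mu$-continuous. **Problem (M).** An interval $I$ is admissible if $I=(t,T]$ or $I=[t,T]$ for some $t\in[0,T)$. A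 solution to (M) (with data $f,g$) on an admissible interval $I$ is a consistent $u\in B(I\times S,D)$ such that for all $r\le t$ in $I$ and $x\in S$, $|u(t,X_t)|$ and $\int_r^t|f(s,X_s,u(s,X_s))|\,\mu(ds)$ are finite and $P_{r,x}$-integrable, $E_{r,x}[u(t,X_t)]=u(r,x)+E_{r,x}[\int_r^tf(s,X_s,u(s,X_s))\,\mu(ds)]$, and $u(T,x)=g(x)$. A solution $u$ on $I$ is $\mu$-admissible if for each $r\in I$ there is a $\mu$-null set $N\in\mathcal{B}([0,T])$ such that $u((N^c\cap[r,T])\times S)$ is relatively compact in $D$ (its closure is a compact subset of $D$). *)

theory Defs
  imports "HOL-Probability.Probability"
begin

section \<open>Spaces\<close>

definition pseudometric_on :: "'a set \<Rightarrow> ('a \<Rightarrow> 'a \<Rightarrow> real) \<Rightarrow> bool" where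
  "pseudometric_on A d \<longleftrightarrow>
     (\<forall>x\<in>A. \<forall>y\<in>A. 0 \<le> d x y \<and> d x y = d y x) \<and>
     (\<forall>x\<in>A. d x x = 0) \<and>
     (\<forall>x\<in>A. \<forall>y\<in>A. \<forall>z\<in>A. d x z \<le> d x y + d y z)"

definition pm_open :: "'a set \<Rightarrow> ('a \<Rightarrow> 'a \<Rightarrow> real) \<Rightarrow> 'a set \<Rightarrow> bool" where
  "pm_open A d U \<longleftrightarrow>
     U \<subseteq> A \<and> (\<forall>x\<in>U. \<exists>e>0. \<forall>y\<in>A. d x y < e \<longrightarrow> y \<in> U)"

definition pm_borel :: "'a set \<Rightarrow> ('a \<Rightarrow> 'a \<Rightarrow> real) \<Rightarrow> 'a measure" where
  "pm_borel A d = sigma A {U. pm_open A d U}"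

definition admissible_pseudometric ::
  "real \<Rightarrow> (real \<times> 's::topological_space \<Rightarrow> real \<times> 's \<Rightarrow> real) \<Rightarrow> bool" where
  "admissible_pseudometric T dS \<longleftrightarrow>
     pseudometric_on ({0..T} \<times> UNIV) dS \<and>
     (\<forall>U. pm_open ({0..T} \<times> UNIV) dS U \<longrightarrow> openin (top_of_set ({0..T} \<times> UNIV)) U)"

definition atom :: "'a measure \<Rightarrow> 'a set \<Rightarrow> bool" where
  "atom M A \<longleftrightarrow> A \<in> sets M \<and> 0 < emeasure M A \<and>
     (\<forall>B\<in>sets M. B \<subseteq> A \<longrightarrow> emeasure M B = 0 \<or> emeasure M B = emeasure M A)"

definition atomless :: "'a measure \<Rightarrow> bool" where
  "atomless M \<longleftrightarrow> (\<nexists>A. atom M A)"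

definition consistent_on ::
  "real set \<Rightarrow> (real \<times> 's \<Rightarrow> real \<times> 's \<Rightarrow> real) \<Rightarrow> (real \<times> 's \<Rightarrow> 'b) \<Rightarrow> bool" where
  "consistent_on I dS u \<longleftrightarrow>
     (\<forall>p\<in>I \<times> UNIV. \<forall>q\<in>I \<times> UNIV. dS p q = 0 \<longrightarrow> u p = u q)"

definition consistent_terminal ::
  "real \<Rightarrow> (real \<times> 's \<Rightarrow> real \<times> 's \<Rightarrow> real) \<Rightarrow> ('s \<Rightarrow> 'b) \<Rightarrow> bool" where
  "consistent_terminal T dS g \<longleftrightarrow> (\<forall>x y. dS (T, x) (T, y) = 0 \<longrightarrow> g x = g y)"


section \<open>The Markov process\<close>

definition natural_sigma ::
  "'w measure \<Rightarrow> (real \<Rightarrow> 'w \<Rightarrow> 's::topological_space) \<Rightarrow> real set \<Rightarrow> 'w measure" where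
  "natural_sigma M X J =
     sigma (space M) {X s -` B \<inter> space M | s B. s \<in> J \<and> B \<in> sets borel}"

definition filtration_on :: "real \<Rightarrow> 'w measure \<Rightarrow> (real \<Rightarrow> 'w measure) \<Rightarrow> bool" where
  "filtration_on T M F \<longleftrightarrow>
     (\<forall>t\<in>{0..T}. subalgebra M (F t)) \<and>
     (\<forall>s\<in>{0..T}. \<forall>t\<in>{0..T}. s \<le> t \<longrightarrow> sets (F s) \<subseteq> sets (F t))"

definition progressive ::
  "real \<Rightarrow> 'w measure \<Rightarrow> (real \<Rightarrow> 'w \<Rightarrow> 's::topological_space) \<Rightarrow> bool" where
  "progressive T M X \<longleftrightarrow>
     (\<forall>t\<in>{0..T}. (\<lambda>(s, \<omega>). X s \<omega>)
        \<in> restrict_space borel {0..t} \<Otimes>\<^sub>M natural_sigma M X {0..t} \<rightarrow>\<^sub>M borel)"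

definition backward_progressive ::
  "real \<Rightarrow> 'w measure \<Rightarrow> (real \<Rightarrow> 'w \<Rightarrow> 's::topological_space) \<Rightarrow> bool" where
  "backward_progressive T M X \<longleftrightarrow>
     (\<forall>t\<in>{0..T}. (\<lambda>(s, \<omega>). X s \<omega>)
        \<in> restrict_space borel {t..T} \<Otimes>\<^sub>M natural_sigma M X {t..T} \<rightarrow>\<^sub>M borel)"

text \<open>\<open>M\<close> only serves as the measurable space \<open>(\<Omega>, \<F>)\<close>; its measure is irrelevant.
  \<open>P r x\<close> is the probability measure $P_{r,x}$.\<close>

definition consistent_progressive_Markov ::
  "real \<Rightarrow> (real \<times> 's::topological_space \<Rightarrow> real \<times> 's \<Rightarrow> real) \<Rightarrow> 'w measure \<Rightarrow>
   (real \<Rightarrow> 'w measure) \<Rightarrow> (real \<Rightarrow> 'w \<Rightarrow> 's) \<Rightarrow> (real \<Rightarrow> 's \<Rightarrow> 'w measure) \<Rightarrow> bool" where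
  "consistent_progressive_Markov T dS M F X P \<longleftrightarrow>
     filtration_on T M F \<and>
     (\<forall>t\<in>{0..T}. X t \<in> F t \<rightarrow>\<^sub>M borel) \<and>
     (\<forall>r\<in>{0..T}. \<forall>x. prob_space (P r x) \<and> sets (P r x) = sets M) \<and>
     (\<forall>s\<in>{0..T}. \<forall>y. AE \<omega> in P s y. \<forall>r\<in>{0..s}. dS (r, X r \<omega>) (r, y) = 0) \<and>
     (\<forall>t\<in>{0..T}. \<forall>B\<in>sets borel.
        consistent_on {0..t} dS (\<lambda>(s, x). measure (P s x) {\<omega>\<in>space M. X t \<omega> \<in> B}) \<and>
        (\<lambda>(s, x). measure (P s x) {\<omega>\<in>space M. X t \<omega> \<in> B})
          \<in> borel_measurable (pm_borel ({0..t} \<times> UNIV) dS)) \<and>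
     (\<forall>r s t x. 0 \<le> r \<and> r \<le> s \<and> s \<le> t \<and> t \<le> T \<longrightarrow> (\<forall>B\<in>sets borel.
        AE \<omega> in P r x.
          real_cond_exp (P r x) (F s) (indicator {\<omega>\<in>space M. X t \<omega> \<in> B}) \<omega>
          = measure (P s (X s \<omega>)) {\<omega>'\<in>space M. X t \<omega>' \<in> B})) \<and>
     progressive T M X \<and> backward_progressive T M X"


section \<open>Regularity with respect to a measure on the time interval\<close>

definition dominated ::
  "real \<Rightarrow> (real \<times> 's \<Rightarrow> real \<times> 's \<Rightarrow> real) \<Rightarrow> real measure \<Rightarrow> (real \<times> 's \<Rightarrow> real) \<Rightarrow> bool" where
  "dominated T dS \<mu> a \<longleftrightarrow>
     a \<in> borel_measurable (pm_borel ({0..T} \<times> UNIV) dS) \<and>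
     (\<forall>p\<in>{0..T} \<times> UNIV. 0 \<le> a p) \<and>
     (\<exists>b. b \<in> borel_measurable (restrict_space borel {0..T}) \<and> (\<forall>s\<in>{0..T}. 0 \<le> b s) \<and>
        integrable \<mu> b \<and> (AE s in \<mu>. \<forall>y. a (s, y) \<le> b s))"

definition neighbourhood_in :: "'a::topological_space set \<Rightarrow> 'a \<Rightarrow> 'a set \<Rightarrow> bool" where
  "neighbourhood_in A w W \<longleftrightarrow>
     W \<subseteq> A \<and> (\<exists>U. openin (top_of_set A) U \<and> w \<in> U \<and> U \<subseteq> W)"

definition locally_bounded ::
  "real \<Rightarrow> (real \<times> 's \<Rightarrow> real \<times> 's \<Rightarrow> real) \<Rightarrow> real measure \<Rightarrow> (real^'k) set \<Rightarrow>
   (real \<times> 's \<Rightarrow> real^'k \<Rightarrow> real^'k) \<Rightarrow> bool" where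
  "locally_bounded T dS \<mu> D f \<longleftrightarrow>
     (\<forall>w\<^sub>0\<in>D. \<exists>W l. neighbourhood_in (closure D) w\<^sub>0 W \<and> dominated T dS \<mu> l \<and>
        (\<forall>p\<in>{0..T} \<times> UNIV. \<forall>w\<in>W \<inter> D. norm (f p w) \<le> l p))"

definition locally_Lipschitz ::
  "real \<Rightarrow> (real \<times> 's \<Rightarrow> real \<times> 's \<Rightarrow> real) \<Rightarrow> real measure \<Rightarrow> (real^'k) set \<Rightarrow>
   (real \<times> 's \<Rightarrow> real^'k \<Rightarrow> real^'k) \<Rightarrow> bool" where
  "locally_Lipschitz T dS \<mu> D f \<longleftrightarrow>
     (\<forall>w\<^sub>0\<in>D. \<exists>W l. neighbourhood_in (closure D) w\<^sub>0 W \<and> dominated T dS \<mu> l \<and>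
        (\<forall>p\<in>{0..T} \<times> UNIV. \<forall>w\<in>W \<inter> D. \<forall>w'\<in>W \<inter> D.
           norm (f p w - f p w') \<le> l p * norm (w - w')))"

definition BC1m ::
  "real \<Rightarrow> (real \<times> 's \<Rightarrow> real \<times> 's \<Rightarrow> real) \<Rightarrow> real measure \<Rightarrow> (real^'k) set \<Rightarrow>
   (real \<times> 's \<Rightarrow> real^'k \<Rightarrow> real^'k) set" where
  "BC1m T dS \<mu> D = {f.
     (\<lambda>(p, w). f p w)
       \<in> borel_measurable (pm_borel ({0..T} \<times> UNIV) dS \<Otimes>\<^sub>M restrict_space borel D) \<and>
     locally_bounded T dS \<mu> D f \<and> locally_Lipschitz T dS \<mu> D f}"


section \<open>The Markovian integral equation\<close>

definition admissible_interval :: "real \<Rightarrow> real set \<Rightarrow> bool" where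
  "admissible_interval T I \<longleftrightarrow> (\<exists>t\<in>{0..<T}. I = {t<..T} \<or> I = {t..T})"

text \<open>In the solution property, finiteness of \<open>\<integral>\<^sub>r\<^sup>t \<bar>f(s, X\<^sub>s, u(s, X\<^sub>s))\<bar> \<mu>(ds)\<close> is required for every
  \<open>\<omega>\<close> and appears as integrability of \<open>s \<mapsto> f(s, X\<^sub>s(\<omega>), u(s, X\<^sub>s(\<omega>)))\<close>, whose measurability holds
  because \<open>X\<close> has Borel measurable paths. Finiteness of \<open>\<bar>u(t, X\<^sub>t)\<bar>\<close> is automatic.\<close>

definition is_solution ::
  "real \<Rightarrow> (real \<times> 's \<Rightarrow> real \<times> 's \<Rightarrow> real) \<Rightarrow> real measure \<Rightarrow> 'w measure \<Rightarrow>
   (real \<Rightarrow> 'w \<Rightarrow> 's) \<Rightarrow> (real \<Rightarrow> 's \<Rightarrow> 'w measure) \<Rightarrow> (real^'k) set \<Rightarrow>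
   (real \<times> 's \<Rightarrow> real^'k \<Rightarrow> real^'k) \<Rightarrow> ('s \<Rightarrow> real^'k) \<Rightarrow> real set \<Rightarrow>
   (real \<times> 's \<Rightarrow> real^'k) \<Rightarrow> bool" where
  "is_solution T dS \<mu> M X P D f g I u \<longleftrightarrow>
     u \<in> pm_borel (I \<times> UNIV) dS \<rightarrow>\<^sub>M restrict_space borel D \<and>
     consistent_on I dS u \<and>
     (\<forall>r\<in>I. \<forall>t\<in>I. \<forall>x. r \<le> t \<longrightarrow>
        integrable (P r x) (\<lambda>\<omega>. norm (u (t, X t \<omega>))) \<and>
        (\<forall>\<omega>\<in>space M. set_integrable \<mu> {r..t} (\<lambda>s. f (s, X s \<omega>) (u (s, X s \<omega>)))) \<and>
        integrable (P r x) (\<lambda>\<omega>. LINT s:{r..t}|\<mu>. norm (f (s, X s \<omega>) (u (s, X s \<omega>)))) \<and>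
        (\<integral>\<omega>. u (t, X t \<omega>) \<partial>P r x)
          = u (r, x) + (\<integral>\<omega>. (LINT s:{r..t}|\<mu>. f (s, X s \<omega>) (u (s, X s \<omega>))) \<partial>P r x)) \<and>
     (\<forall>x. u (T, x) = g x)"

definition mu_admissible ::
  "real \<Rightarrow> real measure \<Rightarrow> (real^'k) set \<Rightarrow> real set \<Rightarrow> (real \<times> 's \<Rightarrow> real^'k) \<Rightarrow> bool" where
  "mu_admissible T \<mu> D I u \<longleftrightarrow>
     (\<forall>r\<in>I. \<exists>N\<in>null_sets \<mu>.
        compact (closure (u ` (({r..T} - N) \<times> UNIV))) \<and>
        closure (u ` (({r..T} - N) \<times> UNIV)) \<subseteq> D)"

end

theory Submission
  imports Defs
begin

text \<open>Off a null set, two \<open>\<mu>\<close>-admissible solutions \<open>u\<close> and \<open>v\<close> take values in a common compact subset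
  \<open>K\<close> of \<open>D\<close>, on which \<open>f\<close> is bounded and Lipschitz with a coefficient dominated by a \<open>\<mu>\<close>-integrable
  \<open>b(s)\<close>. Subtracting the two integral equations on \<open>[r, T]\<close> bounds \<open>u - v\<close> at time \<open>r\<close>, uniformly in
  \<open>x\<close>, by \<open>c\<close> times the integral of \<open>b\<close> over \<open>[r, t]\<close>, if \<open>u = v\<close> after time \<open>t\<close> and \<open>\<bar>u - v\<bar> \<le> c\<close> on
  \<open>[r, t]\<close>. Where this integral is at most \<open>1/2\<close>, iteration gives \<open>u = v\<close> on \<open>[r, t]\<close>. As \<open>\<mu>\<close> has no
  atoms, the set of times from which on \<open>u = v\<close> can be extended to the left until it is everything.\<close>

section \<open>Measurability for the pseudometric, and of time integrals\<close>

text \<open>For a basis set \<open>Q\<close> of the first factor, the union of all open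
  \<open>V\<close> with \<open>Q \<times> V \<subseteq> U\<close> is again open, so \<open>U\<close>
  is a countable union of open rectangles. The first factor will be the time axis.\<close>

lemma open_Times_sets_borel:
  fixes U :: "('a::second_countable_topology \<times> 'b::topological_space) set"
  assumes "open U"
  shows "U \<in> sets (borel \<Otimes>\<^sub>M borel)"
proof -
  obtain B :: "'a set set" where B: "countable B" "topological_basis B"
    using ex_countable_basis by auto
  define V where "V Q = \<Union>{V. open V \<and> Q \<times> V \<subseteq> U}" for Q :: "'a set"
  have U_eq: "U = (\<Union>Q\<in>B. Q \<times> V Q)"
  proof (intro equalityI subsetI)
    fix p assume "p \<in> U"
    then obtain A C where AC: "open A" "open C" "p \<in> A \<times> C" "A \<times> C \<subseteq> U"
      using open_prod_elim[OF assms] by blast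
    then obtain Q where "Q \<in> B" "fst p \<in> Q" "Q \<subseteq> A"
      using topological_basisE[OF B(2) AC(1), of "fst p"] by (metis mem_Times_iff)
    moreover have "snd p \<in> V Q"
      unfolding V_def using AC \<open>Q \<subseteq> A\<close> by (auto intro!: exI[of _ C])
    ultimately show "p \<in> (\<Union>Q\<in>B. Q \<times> V Q)"
      by (metis UN_I mem_Times_iff)
  qed (auto simp: V_def)
  have "Q \<times> V Q \<in> sets (borel \<Otimes>\<^sub>M borel)" if "Q \<in> B" for Q
    using that topological_basis_open[OF B(2)] unfolding V_def
    by (intro pair_measureI borel_open) auto
  then show ?thesis
    unfolding U_eq by (intro sets.countable_UN'[OF B(1)]) blast
qed

text \<open>The union of balls taken in \<open>A\<close>, with centres in \<open>U\<close> and the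
  radii that witness openness in \<open>B\<close>, is open by the triangle inequality and meets
  \<open>B\<close> exactly in \<open>U\<close>. This reduces the pseudometric topology on
  \<open>I \<times> S\<close> to that on \<open>[0, T] \<times> S\<close>, which admissibility
  compares with the product topology.\<close>

lemma pm_open_extend:
  assumes "pseudometric_on A d" and "B \<subseteq> A" and "pm_open B d U"
  obtains V where "pm_open A d V" and "U = V \<inter> B"
proof -
  from assms(3) have U: "U \<subseteq> B" "\<forall>x\<in>U. \<exists>e>0. \<forall>y\<in>B. d x y < e \<longrightarrow> y \<in> U"
    by (auto simp: pm_open_def)
  then obtain e where e: "\<And>x. x \<in> U \<Longrightarrow> e x > 0"
    "\<And>x y. x \<in> U \<Longrightarrow> y \<in> B \<Longrightarrow> d x y < e x \<Longrightarrow> y \<in> U"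
    by metis
  define V where "V = {y\<in>A. \<exists>x\<in>U. d x y < e x}"
  have "\<exists>r>0. \<forall>z\<in>A. d y z < r \<longrightarrow> z \<in> V" if y: "y \<in> V" for y
  proof -
    obtain x where x: "x \<in> U" "d x y < e x" "y \<in> A"
      using y by (auto simp: V_def)
    have "z \<in> V" if "z \<in> A" "d y z < e x - d x y" for z
    proof -
      have "d x z \<le> d x y + d y z"
        using assms(1,2) U(1) x that unfolding pseudometric_on_def by blast
      then show ?thesis
        using x that by (auto simp: V_def intro!: bexI[of _ x])
    qed
    then show ?thesis
      using x by (intro exI[of _ "e x - d x y"]) auto
  qed
  moreover have "V \<subseteq> A"
    by (auto simp: V_def)
  ultimately have "pm_open A d V"
    unfolding pm_open_def by blast
  moreover have "U = V \<inter> B"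
  proof (intro equalityI subsetI)
    fix x assume "x \<in> U"
    moreover from this have "d x x = 0"
      using assms(1,2) U(1) unfolding pseudometric_on_def by blast
    ultimately show "x \<in> V \<inter> B"
      using e(1)[of x] U(1) assms(2) by (auto simp: V_def intro!: bexI[of _ x])
  next
    fix x assume "x \<in> V \<inter> B"
    then show "x \<in> U"
      using e(2) by (auto simp: V_def)
  qed
  ultimately show thesis
    by (rule that)
qed

text \<open>Each generator of the target is the trace of a set open in the product topology, whose
  preimage is measurable by \<open>open_Times_sets_borel\<close>. The lemma serves the space-time
  map from \<open>(s, \<omega>)\<close> to \<open>(s, X s \<omega>)\<close>.\<close>

lemma measurable_into_pm_borel:
  assumes dS: "admissible_pseudometric T dS"
    and A: "A \<in> sets borel" "A \<subseteq> {0..T}"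
    and \<phi>: "\<phi> \<in> N \<rightarrow>\<^sub>M borel \<Otimes>\<^sub>M borel" "\<phi> \<in> space N \<rightarrow> A \<times> UNIV"
  shows "\<phi> \<in> N \<rightarrow>\<^sub>M pm_borel (A \<times> UNIV) dS"
  unfolding pm_borel_def
proof (rule measurable_measure_of)
  fix U assume "U \<in> {U. pm_open (A \<times> UNIV) dS U}"
  moreover have "pseudometric_on ({0..T} \<times> UNIV) dS"
    using dS by (auto simp: admissible_pseudometric_def)
  ultimately obtain V where V: "pm_open ({0..T} \<times> UNIV) dS V" "U = V \<inter> A \<times> UNIV"
    using A(2) by (auto elim: pm_open_extend[where B = "A \<times> UNIV"])
  then obtain W where W: "open W" "V = ({0..T} \<times> UNIV) \<inter> W"
    using dS by (auto simp: admissible_pseudometric_def openin_open)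
  have "U = (A \<times> UNIV) \<inter> W"
    using V(2) W(2) A(2) by auto
  then have "\<phi> -` U \<inter> space N = \<phi> -` W \<inter> space N"
    using \<phi>(2) by auto
  then show "\<phi> -` U \<inter> space N \<in> sets N"
    using measurable_sets[OF \<phi>(1) open_Times_sets_borel[OF W(1)]] by simp
qed (use \<phi>(2) in \<open>auto simp: pm_open_def\<close>)

lemma backward_progressive_measurable:
  assumes bp: "backward_progressive T M X" and r: "r \<in> {0..T}"
    and X: "\<And>t. t \<in> {0..T} \<Longrightarrow> X t \<in> M \<rightarrow>\<^sub>M borel"
  shows "(\<lambda>(s, \<omega>). X s \<omega>) \<in> restrict_space borel {r..T} \<Otimes>\<^sub>M M \<rightarrow>\<^sub>M borel"
proof -
  let ?N = "natural_sigma M X {r..T}"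
  have "(\<lambda>\<omega>. \<omega>) \<in> M \<rightarrow>\<^sub>M ?N"
    unfolding natural_sigma_def
  proof (rule measurable_measure_of)
    fix A assume "A \<in> {X s -` B \<inter> space M |s B. s \<in> {r..T} \<and> B \<in> sets borel}"
    then show "(\<lambda>\<omega>. \<omega>) -` A \<inter> space M \<in> sets M"
      using X r by (auto intro!: sets.Int measurable_sets)
  qed auto
  then have "(\<lambda>q. (fst q, snd q)) \<in> restrict_space borel {r..T} \<Otimes>\<^sub>M M \<rightarrow>\<^sub>M
      restrict_space borel {r..T} \<Otimes>\<^sub>M ?N"
    by (intro measurable_Pair measurable_fst measurable_compose[OF measurable_snd])
  moreover have "(\<lambda>(s, \<omega>). X s \<omega>) \<in> restrict_space borel {r..T} \<Otimes>\<^sub>M ?N \<rightarrow>\<^sub>M borel"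
    using bp r by (auto simp: backward_progressive_def)
  ultimately show ?thesis
    using measurable_comp by (fastforce simp: comp_def)
qed

text \<open>The measure \<open>\<mu>\<close> need not be \<open>\<sigma>\<close>-finite, but the integrand vanishes almost everywhere outside
  \<open>{b > 0}\<close>, so \<open>\<mu>\<close> may be replaced by the finite measure with density \<open>b\<close>.\<close>

lemma borel_measurable_integral_dominated:
  fixes h :: "'w \<Rightarrow> 'a \<Rightarrow> 'b::{banach, second_countable_topology}"
  assumes h: "case_prod h \<in> borel_measurable (M \<Otimes>\<^sub>M \<mu>)"
    and b: "integrable \<mu> b" "\<And>s. s \<in> space \<mu> \<Longrightarrow> 0 \<le> b s"
    and hb: "\<And>\<omega>. \<omega> \<in> space M \<Longrightarrow> AE s in \<mu>. norm (h \<omega> s) \<le> b s"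
  shows "(\<lambda>\<omega>. LINT s|\<mu>. h \<omega> s) \<in> borel_measurable M"
proof -
  let ?\<nu> = "density \<mu> (\<lambda>s. ennreal (b s))"
  have [measurable]: "b \<in> borel_measurable \<mu>"
    using b(1) by simp
  have b_AE: "AE s in \<mu>. 0 \<le> b s"
    using b(2) by simp
  have "emeasure ?\<nu> (space ?\<nu>) = (\<integral>\<^sup>+s. b s \<partial>\<mu>)"
    by (subst emeasure_density) (auto intro!: nn_integral_cong)
  also have "\<dots> < \<infinity>"
    using b(1) b_AE by (simp add: nn_integral_eq_integral)
  finally interpret \<nu>: finite_measure ?\<nu>
    by (intro finite_measureI) auto
  have hm [measurable]: "h \<omega> \<in> borel_measurable \<mu>" if "\<omega> \<in> space M" for \<omega>
    using h that by measurable
  have "(LINT s|\<mu>. h \<omega> s) = (LINT s|?\<nu>. (1 / b s) *\<^sub>R h \<omega> s)" if \<omega>: "\<omega> \<in> space M" for \<omega>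
  proof -
    note [measurable] = hm[OF \<omega>]
    have "(LINT s|?\<nu>. (1 / b s) *\<^sub>R h \<omega> s) = (LINT s|\<mu>. b s *\<^sub>R ((1 / b s) *\<^sub>R h \<omega> s))"
      using b_AE by (intro integral_density) auto
    \<comment> \<open>The factors cancel where \<open>b s > 0\<close>. Where \<open>b s = 0\<close>,
      the left integrand is 0, and for almost every such \<open>s\<close> the bound forces
      \<open>h \<omega> s = 0\<close> as well.\<close>
    also have "\<dots> = (LINT s|\<mu>. h \<omega> s)"
      using hb[OF \<omega>] by (intro integral_cong_AE) auto
    finally show ?thesis ..
  qed
  moreover have "case_prod (\<lambda>\<omega> s. (1 / b s) *\<^sub>R h \<omega> s) \<in> borel_measurable (M \<Otimes>\<^sub>M ?\<nu>)"
    using h by (subst measurable_cong_sets[OF sets_pair_measure_cong refl]) (auto simp: split_beta')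
  then have "(\<lambda>\<omega>. LINT s|?\<nu>. (1 / b s) *\<^sub>R h \<omega> s) \<in> borel_measurable M"
    by (rule \<nu>.borel_measurable_lebesgue_integral)
  ultimately show ?thesis
    by (simp cong: measurable_cong)
qed

section \<open>Uniform bounds for the coefficient on compact sets\<close>

lemma dominated_bound:
  assumes "dominated T dS \<mu> l" and "sets \<mu> = sets (restrict_space borel {0..T})"
  obtains b where "integrable \<mu> b" and "\<And>s. s \<in> space \<mu> \<Longrightarrow> 0 \<le> b s"
    and "AE s in \<mu>. \<forall>y. l (s, y) \<le> b s"
  using assms sets_eq_imp_space_eq[OF assms(2)] unfolding dominated_def by auto

text \<open>If two points of the compact set are closer than a Lebesgue number of the cover, they lie in a
  common member, where the local Lipschitz condition applies; otherwise, the local bound suffices.\<close>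

lemma BC1m_compact:
  fixes dS :: "real \<times> 's \<Rightarrow> real \<times> 's \<Rightarrow> real"
  assumes f: "f \<in> BC1m T dS \<mu> D" and \<mu>: "sets \<mu> = sets (restrict_space borel {0..T})"
    and K: "compact K" "K \<subseteq> D"
  obtains b where "integrable \<mu> b" and "\<And>s. s \<in> space \<mu> \<Longrightarrow> 0 \<le> b s"
    and "AE s in \<mu>. \<forall>y. \<forall>w\<in>K. \<forall>w'\<in>K.
      norm (f (s, y) w) \<le> b s \<and> norm (f (s, y) w - f (s, y) w') \<le> b s * norm (w - w')"
proof -
  have space_\<mu>: "space \<mu> = {0..T}"
    using sets_eq_imp_space_eq[OF \<mu>] by simp
  define Q where "Q V b \<longleftrightarrow> integrable \<mu> b \<and> (\<forall>s\<in>space \<mu>. 0 \<le> b s) \<and>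
      (AE s in \<mu>. \<forall>y. \<forall>w\<in>V \<inter> D. \<forall>w'\<in>V \<inter> D.
        norm (f (s, y) w) \<le> b s \<and> norm (f (s, y) w - f (s, y) w') \<le> b s * norm (w - w'))"
    for V b
  have "\<exists>V b. open V \<and> z \<in> V \<and> Q V b" if z: "z \<in> K" for z
  proof -
    have "z \<in> D"
      using z K by auto
    obtain W1 l1 where 1: "neighbourhood_in (closure D) z W1" "dominated T dS \<mu> l1"
      "\<forall>p\<in>{0..T} \<times> UNIV. \<forall>w\<in>W1 \<inter> D. norm (f p w) \<le> l1 p"
      using f \<open>z \<in> D\<close> unfolding BC1m_def locally_bounded_def by blast
    obtain W2 l2 where 2: "neighbourhood_in (closure D) z W2" "dominated T dS \<mu> l2"
      "\<forall>p\<in>{0..T} \<times> UNIV. \<forall>w\<in>W2 \<inter> D. \<forall>w'\<in>W2 \<inter> D.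
           norm (f p w - f p w') \<le> l2 p * norm (w - w')"
      using f \<open>z \<in> D\<close> unfolding BC1m_def locally_Lipschitz_def by blast
    \<comment> \<open>The neighbourhoods are relative to \<open>closure D\<close>. Passing to open
      sets of the whole space makes a finite subcover and a Lebesgue number available.\<close>
    obtain V1 where V1: "open V1" "z \<in> V1" "closure D \<inter> V1 \<subseteq> W1"
      using 1(1) unfolding neighbourhood_in_def openin_open by blast
    obtain V2 where V2: "open V2" "z \<in> V2" "closure D \<inter> V2 \<subseteq> W2"
      using 2(1) unfolding neighbourhood_in_def openin_open by blast
    obtain b1 where b1: "integrable \<mu> b1" "\<And>s. s \<in> space \<mu> \<Longrightarrow> 0 \<le> b1 s"
      "AE s in \<mu>. \<forall>y. l1 (s, y) \<le> b1 s"
      using dominated_bound[OF 1(2) \<mu>] by blast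
    obtain b2 where b2: "integrable \<mu> b2" "\<And>s. s \<in> space \<mu> \<Longrightarrow> 0 \<le> b2 s"
      "AE s in \<mu>. \<forall>y. l2 (s, y) \<le> b2 s"
      using dominated_bound[OF 2(2) \<mu>] by blast
    have sub: "V1 \<inter> V2 \<inter> D \<subseteq> W1 \<inter> D" "V1 \<inter> V2 \<inter> D \<subseteq> W2 \<inter> D"
      using V1(3) V2(3) closure_subset by auto
    have "AE s in \<mu>. \<forall>y. \<forall>w\<in>(V1 \<inter> V2) \<inter> D. \<forall>w'\<in>(V1 \<inter> V2) \<inter> D.
        norm (f (s, y) w) \<le> b1 s + b2 s \<and>
        norm (f (s, y) w - f (s, y) w') \<le> (b1 s + b2 s) * norm (w - w')"
      using b1(3) b2(3) AE_space
    proof eventually_elim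
      case (elim s)
      show ?case
      proof (intro allI ballI conjI)
        fix y :: 's and w w' assume w: "w \<in> V1 \<inter> V2 \<inter> D" "w' \<in> V1 \<inter> V2 \<inter> D"
        have p: "(s, y) \<in> {0..T} \<times> UNIV"
          using elim(3) space_\<mu> by simp
        have "norm (f (s, y) w) \<le> l1 (s, y)"
          using 1(3) p w sub by blast
        then show "norm (f (s, y) w) \<le> b1 s + b2 s"
          using elim(1)[rule_format, of y] b2(2)[OF elim(3)] by simp
        have "norm (f (s, y) w - f (s, y) w') \<le> l2 (s, y) * norm (w - w')"
          using 2(3) p w sub by blast
        also have "\<dots> \<le> (b1 s + b2 s) * norm (w - w')"
          using elim(2)[rule_format, of y] b1(2)[OF elim(3)] by (intro mult_right_mono) auto
        finally show "norm (f (s, y) w - f (s, y) w') \<le> (b1 s + b2 s) * norm (w - w')" .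
      qed
    qed
    moreover have "open (V1 \<inter> V2)" "z \<in> V1 \<inter> V2"
      using V1(1,2) V2(1,2) by auto
    moreover have "integrable \<mu> (\<lambda>s. b1 s + b2 s)" "\<forall>s\<in>space \<mu>. 0 \<le> b1 s + b2 s"
      using b1(1,2) b2(1,2) by auto
    ultimately show ?thesis
      unfolding Q_def by blast
  qed
  then obtain V \<beta> where V: "\<And>z. z \<in> K \<Longrightarrow> open (V z)" "\<And>z. z \<in> K \<Longrightarrow> z \<in> V z"
    and "\<And>z. z \<in> K \<Longrightarrow> Q (V z) (\<beta> z)"
    by metis
  then have \<beta>: "\<And>z. z \<in> K \<Longrightarrow> integrable \<mu> (\<beta> z)" "\<And>z s. z \<in> K \<Longrightarrow> s \<in> space \<mu> \<Longrightarrow> 0 \<le> \<beta> z s"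
    and bound: "\<And>z. z \<in> K \<Longrightarrow> AE s in \<mu>. \<forall>y. \<forall>w\<in>V z \<inter> D. \<forall>w'\<in>V z \<inter> D.
        norm (f (s, y) w) \<le> \<beta> z s \<and> norm (f (s, y) w - f (s, y) w') \<le> \<beta> z s * norm (w - w')"
    unfolding Q_def by blast+
  obtain Z where Z: "Z \<subseteq> K" "finite Z" "K \<subseteq> (\<Union>z\<in>Z. V z)"
    using compactE_image[OF K(1), of K V] V by blast
  have "open G" if "G \<in> V ` Z" for G
    using that Z(1) V(1) by blast
  then obtain \<delta> where \<delta>: "\<delta> > 0" "\<forall>w\<in>K. \<exists>G\<in>V ` Z. ball w \<delta> \<subseteq> G"
    using Heine_Borel_lemma[OF K(1) Z(3)] by metis
  define B where "B s = (\<Sum>z\<in>Z. \<beta> z s)" for s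
  have le_B: "\<beta> z s \<le> B s" if "z \<in> Z" "s \<in> space \<mu>" for z s
    unfolding B_def using that Z \<beta>(2) by (intro member_le_sum) auto
  have B_nonneg: "0 \<le> B s" if "s \<in> space \<mu>" for s
    unfolding B_def using that Z \<beta>(2) by (intro sum_nonneg) auto
  \<comment> \<open>The summand \<open>B s\<close> covers the norm bound and pairs at distance below
    \<delta>. For other pairs the difference is at most \<open>2 * B s\<close>, hence at most
    \<open>2 / \<delta> * B s * norm (w - w')\<close>, because the distance is at least
    \<delta>.\<close>
  let ?b = "\<lambda>s. B s + 2 / \<delta> * B s"
  have "integrable \<mu> ?b"
    unfolding B_def using Z(1) \<beta>(1)
    by (intro Bochner_Integration.integrable_add Bochner_Integration.integrable_sum
        integrable_mult_right) blast+
  moreover have "0 \<le> ?b s" if "s \<in> space \<mu>" for s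
    using B_nonneg[OF that] \<delta>(1) by simp
  moreover have "AE s in \<mu>. \<forall>z\<in>Z. \<forall>y. \<forall>w\<in>V z \<inter> D. \<forall>w'\<in>V z \<inter> D.
        norm (f (s, y) w) \<le> \<beta> z s \<and> norm (f (s, y) w - f (s, y) w') \<le> \<beta> z s * norm (w - w')"
    using Z(1) by (intro AE_finite_allI[OF Z(2)] bound) blast
  then have "AE s in \<mu>. \<forall>y. \<forall>w\<in>K. \<forall>w'\<in>K.
      norm (f (s, y) w) \<le> ?b s \<and> norm (f (s, y) w - f (s, y) w') \<le> ?b s * norm (w - w')"
    using AE_space
  proof eventually_elim
    case (elim s)
    have le_b: "B s \<le> ?b s"
      using B_nonneg[OF elim(2)] \<delta>(1) by simp
    have norm_le: "norm (f (s, y) w) \<le> B s" if "w \<in> K" for y :: 's and w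
    proof -
      obtain z where "z \<in> Z" "w \<in> V z \<inter> D"
        using \<open>w \<in> K\<close> Z(3) K(2) by blast
      then have "norm (f (s, y) w) \<le> \<beta> z s"
        using elim(1) by blast
      also have "\<dots> \<le> B s"
        by (rule le_B[OF \<open>z \<in> Z\<close> elim(2)])
      finally show ?thesis .
    qed
    have "norm (f (s, y) w - f (s, y) w') \<le> ?b s * norm (w - w')"
      if w: "w \<in> K" "w' \<in> K" for y :: 's and w w'
    proof (cases "norm (w - w') < \<delta>")
      case True
      obtain z where z: "z \<in> Z" "ball w \<delta> \<subseteq> V z"
        using \<delta> w by blast
      then have "w \<in> V z \<inter> D" "w' \<in> V z \<inter> D"
        using True w K(2) \<delta>(1) by (auto simp: dist_norm)
      then have "norm (f (s, y) w - f (s, y) w') \<le> \<beta> z s * norm (w - w')"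
        using elim(1) z by blast
      also have "\<dots> \<le> ?b s * norm (w - w')"
        using le_B[OF z(1) elim(2)] le_b by (intro mult_right_mono) auto
      finally show ?thesis .
    next
      case False
      have "norm (f (s, y) w - f (s, y) w') \<le> norm (f (s, y) w) + norm (f (s, y) w')"
        by (rule norm_triangle_ineq4)
      also have "\<dots> \<le> B s + B s"
        by (intro add_mono norm_le w)
      also have "\<dots> = 2 / \<delta> * B s * \<delta>"
        using \<delta>(1) by simp
      also have "\<dots> \<le> ?b s * norm (w - w')"
        using False B_nonneg[OF elim(2)] \<delta>(1) by (intro mult_mono) auto
      finally show ?thesis .
    qed
    then show ?case
      using order_trans[OF norm_le le_b] by blast
  qed
  ultimately show thesis
    by (rule that)
qed

section \<open>Integrals with respect to an atomless measure\<close>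

lemma atomless_singleton:
  assumes "atomless \<mu>" and "{t} \<in> sets \<mu>"
  shows "emeasure \<mu> {t} = 0"
proof (rule ccontr)
  assume "emeasure \<mu> {t} \<noteq> 0"
  then have "atom \<mu> {t}"
    using assms(2) by (auto simp: atom_def subset_singleton_iff zero_less_iff_neq_zero)
  then show False
    using assms(1) by (auto simp: atomless_def)
qed

lemma atomless_integral_singleton:
  fixes b :: "'a \<Rightarrow> 'b::{banach, second_countable_topology}"
  assumes "atomless \<mu>" and "{t} \<in> sets \<mu>"
  shows "(LINT s:{t}|\<mu>. b s) = 0"
proof -
  have "{t} \<in> null_sets \<mu>"
    using assms by (intro null_setsI atomless_singleton)
  then have "AE s in \<mu>. indicator {t} s *\<^sub>R b s = 0"
    by (rule AE_I'[of "{t}"]) (auto simp: indicator_def)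
  then show ?thesis
    unfolding set_lebesgue_integral_def by (rule integral_eq_zero_AE)
qed

text \<open>As \<open>r\<close> increases to \<open>t\<close>, the indicators of
  \<open>{r..t}\<close> shrink to that of \<open>{t}\<close>. Dominated convergence with majorant
  \<open>\<bar>b\<bar>\<close> sends the integrals to the integral over \<open>{t}\<close>, which is
  0 in the absence of atoms.\<close>

lemma atomless_small_integral:
  fixes b :: "real \<Rightarrow> real"
  assumes \<mu>: "sets \<mu> = sets (restrict_space borel {0..T})" "atomless \<mu>"
    and b: "integrable \<mu> b" and t: "0 \<le> a" "a < t" "t \<le> T" and "e > 0"
  obtains r where "a \<le> r" "r < t" "(LINT s:{r..t}|\<mu>. b s) \<le> e"
proof -
  \<comment> \<open>Since \<open>Suc n\<close> starts at 1, \<open>\<rho> 0 = a\<close>, and all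
    these times stay in \<open>[a, t)\<close> while increasing to \<open>t\<close>.\<close>
  define \<rho> where "\<rho> n = t - (t - a) / real (Suc n)" for n
  have icc: "{x..y} \<inter> {0..T} \<in> sets \<mu>" for x y :: real
    unfolding \<mu>(1) by (auto simp: sets_restrict_space)
  have ind [measurable]: "indicat_real {x..y} \<in> borel_measurable \<mu>" for x y :: real
    using sets_eq_imp_space_eq[OF \<mu>(1)] icc[of x y] by (simp add: borel_measurable_indicator_iff)
  have [measurable]: "b \<in> borel_measurable \<mu>"
    using b by simp
  have "\<rho> \<longlonglongrightarrow> t - 0"
    unfolding \<rho>_def by (intro tendsto_diff tendsto_const LIMSEQ_Suc lim_const_over_n)
  then have \<rho>_lim: "\<rho> \<longlonglongrightarrow> t"
    by simp
  have \<rho>: "a \<le> \<rho> n" "\<rho> n < t" for n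
    using t(2) mult_right_mono[of a t "real n"] by (auto simp: \<rho>_def field_simps)
  have "(\<lambda>n. LINT s|\<mu>. indicator {\<rho> n..t} s *\<^sub>R b s) \<longlonglongrightarrow> (LINT s|\<mu>. indicator {t..t} s *\<^sub>R b s)"
  proof (rule integral_dominated_convergence[where w = "\<lambda>s. \<bar>b s\<bar>"])
    show "AE s in \<mu>. (\<lambda>n. indicator {\<rho> n..t} s *\<^sub>R b s) \<longlonglongrightarrow> indicator {t..t} s *\<^sub>R b s"
    proof (intro AE_I2 tendsto_scaleR tendsto_const)
      fix s
      have "\<forall>\<^sub>F n in sequentially. indicat_real {\<rho> n..t} s = indicator {t..t} s"
      proof (cases "s < t")
        case True
        show ?thesis
          using order_tendstoD(1)[OF \<rho>_lim True]
          by (rule eventually_mono) (use True in \<open>auto simp: indicator_def\<close>)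
      next
        case False
        have "indicat_real {\<rho> n..t} s = indicator {t..t} s" for n
          using False \<rho>(2)[of n] by (auto simp: indicator_def)
        then show ?thesis
          by simp
      qed
      then show "(\<lambda>n. indicat_real {\<rho> n..t} s) \<longlonglongrightarrow> indicator {t..t} s"
        by (rule tendsto_eventually)
    qed
    show "(\<lambda>s. indicator {t..t} s *\<^sub>R b s) \<in> borel_measurable \<mu>"
      "(\<lambda>s. indicator {\<rho> n..t} s *\<^sub>R b s) \<in> borel_measurable \<mu>" for n
      by (intro borel_measurable_scaleR ind borel_measurable_integrable[OF b])+
  qed (use b in \<open>auto simp: indicator_def\<close>)
  moreover have "(LINT s:{t}|\<mu>. b s) = 0"
    using icc[of t t] t by (intro atomless_integral_singleton[OF \<mu>(2)]) auto
  ultimately have "(\<lambda>n. LINT s:{\<rho> n..t}|\<mu>. b s) \<longlonglongrightarrow> 0"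
    by (simp add: set_lebesgue_integral_def)
  from order_tendstoD(2)[OF this \<open>e > 0\<close>] obtain n where "(LINT s:{\<rho> n..t}|\<mu>. b s) < e"
    by (auto simp: eventually_sequentially)
  then show thesis
    using \<rho>[of n] by (intro that[of "\<rho> n"]) auto
qed

section \<open>Comparison of two solutions\<close>

text \<open>Joint measurability in \<omega> and \<open>s\<close> is what makes the time integral a
  random variable. The integrand is the composition of \<open>f\<close> with the space-time process
  and the value of \<open>u\<close> along it.\<close>

lemma solution_integrand_measurable:
  fixes X :: "real \<Rightarrow> 'w \<Rightarrow> 's::topological_space"
    and f :: "real \<times> 's \<Rightarrow> real^'k \<Rightarrow> real^'k"
  assumes \<mu>: "sets \<mu> = sets (restrict_space borel {0..T})"
    and dS: "admissible_pseudometric T dS"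
    and Markov: "consistent_progressive_Markov T dS M F X P"
    and f: "f \<in> BC1m T dS \<mu> D"
    and I: "I \<in> sets borel" "I \<subseteq> {0..T}" "{r..T} \<subseteq> I" "r \<in> I"
    and u: "u \<in> pm_borel (I \<times> UNIV) dS \<rightarrow>\<^sub>M restrict_space borel D"
  shows "case_prod (\<lambda>\<omega> s. indicator {r..T} s *\<^sub>R f (s, X s \<omega>) (u (s, X s \<omega>)))
    \<in> borel_measurable (M \<Otimes>\<^sub>M \<mu>)"
proof -
  let ?Q = "restrict_space borel {r..T} \<Otimes>\<^sub>M M"
  let ?\<phi> = "\<lambda>q. (fst q, X (fst q) (snd q))"
  have space_\<mu>: "space \<mu> = {0..T}"
    using sets_eq_imp_space_eq[OF \<mu>] by simp
  have r: "0 \<le> r" "r \<le> T"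
    using I by auto
  have X: "X t \<in> M \<rightarrow>\<^sub>M borel" if "t \<in> {0..T}" for t
  proof (rule measurable_from_subalg)
    show "subalgebra M (F t)" "X t \<in> F t \<rightarrow>\<^sub>M borel"
      using Markov that by (simp_all add: consistent_progressive_Markov_def filtration_on_def)
  qed
  have "backward_progressive T M X"
    using Markov by (simp add: consistent_progressive_Markov_def)
  then have "(\<lambda>(s, \<omega>). X s \<omega>) \<in> ?Q \<rightarrow>\<^sub>M borel"
    using r X by (intro backward_progressive_measurable) auto
  moreover have "fst \<in> ?Q \<rightarrow>\<^sub>M borel"
    by (rule measurable_compose[OF measurable_fst]) (rule measurable_restrict_space1, simp)
  ultimately have \<phi>: "?\<phi> \<in> ?Q \<rightarrow>\<^sub>M borel \<Otimes>\<^sub>M borel"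
    by (intro measurable_Pair) (simp_all add: split_beta')
  \<comment> \<open>\<open>f\<close> is measurable over \<open>[0, T] \<times> S\<close> and
    \<open>u\<close> over \<open>I \<times> S\<close>, each for its own pseudometric Borel
    \<sigma>-algebra, so the space-time map has to be measurable into both.\<close>
  have "?\<phi> \<in> ?Q \<rightarrow>\<^sub>M pm_borel ({0..T} \<times> UNIV) dS"
    using r by (intro measurable_into_pm_borel[OF dS _ _ \<phi>]) (auto simp: space_pair_measure)
  moreover have "?\<phi> \<in> ?Q \<rightarrow>\<^sub>M pm_borel (I \<times> UNIV) dS"
    using I by (intro measurable_into_pm_borel[OF dS _ _ \<phi>]) (auto simp: space_pair_measure)
  then have "(\<lambda>q. u (?\<phi> q)) \<in> ?Q \<rightarrow>\<^sub>M restrict_space borel D"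
    by (rule measurable_compose[OF _ u])
  ultimately have "(\<lambda>q. (?\<phi> q, u (?\<phi> q)))
      \<in> ?Q \<rightarrow>\<^sub>M pm_borel ({0..T} \<times> UNIV) dS \<Otimes>\<^sub>M restrict_space borel D"
    by (rule measurable_Pair)
  moreover have "(\<lambda>(p, w). f p w)
      \<in> borel_measurable (pm_borel ({0..T} \<times> UNIV) dS \<Otimes>\<^sub>M restrict_space borel D)"
    using f by (simp add: BC1m_def)
  ultimately have fm: "(\<lambda>q. f (?\<phi> q) (u (?\<phi> q))) \<in> borel_measurable ?Q"
    by (auto dest: measurable_compose)
  have id: "(\<lambda>s. s) \<in> \<mu> \<rightarrow>\<^sub>M borel"
    unfolding measurable_cong_sets[OF \<mu> refl] by (rule measurable_restrict_space1) simp
  have snd [measurable]: "snd \<in> M \<Otimes>\<^sub>M \<mu> \<rightarrow>\<^sub>M borel"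
    by (rule measurable_compose[OF measurable_snd id])
  \<comment> \<open>Times before \<open>r\<close> lie outside \<open>?Q\<close>. Replacing
    \<open>s\<close> by \<open>max r s\<close> lands in it without changing times from
    \<open>r\<close> on, and the indicator hides the changed ones.\<close>
  have "(\<lambda>q. (max r (snd q), fst q)) \<in> M \<Otimes>\<^sub>M \<mu> \<rightarrow>\<^sub>M ?Q"
    using r by (intro measurable_Pair measurable_restrict_space2)
      (auto simp: space_pair_measure space_\<mu>)
  then have "(\<lambda>q. f (?\<phi> (max r (snd q), fst q)) (u (?\<phi> (max r (snd q), fst q))))
      \<in> borel_measurable (M \<Otimes>\<^sub>M \<mu>)"
    by (rule measurable_compose[OF _ fm])
  then have "(\<lambda>q. indicator {r..T} (snd q) *\<^sub>R
      f (?\<phi> (max r (snd q), fst q)) (u (?\<phi> (max r (snd q), fst q)))) \<in> borel_measurable (M \<Otimes>\<^sub>M \<mu>)"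
    by (intro borel_measurable_scaleR measurable_compose[OF snd]) auto
  also have "(\<lambda>q. indicator {r..T} (snd q) *\<^sub>R
      f (?\<phi> (max r (snd q), fst q)) (u (?\<phi> (max r (snd q), fst q))))
      = case_prod (\<lambda>\<omega> s. indicator {r..T} s *\<^sub>R f (s, X s \<omega>) (u (s, X s \<omega>)))"
    by (auto simp: fun_eq_iff indicator_def max_def)
  finally show ?thesis .
qed

text \<open>Both solutions agree at time \<open>T\<close>, so subtracting the equations on
  \<open>[r, T]\<close> leaves the difference of two expected time integrals. The Lipschitz bound
  acts on \<open>[r, t]\<close>, and after \<open>t\<close> the integrands coincide. The estimate by
  \<open>c\<close> enters under the \<mu>-integral and is therefore assumed off \<open>N\<close>,
  whereas the conclusion holds at \<open>r\<close> itself, even if \<open>r\<close> lies in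
  \<open>N\<close>.\<close>

lemma solution_difference_bound:
  fixes X :: "real \<Rightarrow> 'w \<Rightarrow> 's::topological_space"
    and f :: "real \<times> 's \<Rightarrow> real^'k \<Rightarrow> real^'k"
  assumes \<mu>: "sets \<mu> = sets (restrict_space borel {0..T})"
    and dS: "admissible_pseudometric T dS"
    and Markov: "consistent_progressive_Markov T dS M F X P"
    and f: "f \<in> BC1m T dS \<mu> D"
    and I: "I \<in> sets borel" "I \<subseteq> {0..T}" "{r..T} \<subseteq> I" "r \<in> I"
    and u: "is_solution T dS \<mu> M X P D f g I u"
    and v: "is_solution T dS \<mu> M X P D f g I v"
    and b: "integrable \<mu> b" "\<And>s. s \<in> space \<mu> \<Longrightarrow> 0 \<le> b s"
      "AE s in \<mu>. \<forall>y. \<forall>w\<in>K. \<forall>w'\<in>K.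
        norm (f (s, y) w) \<le> b s \<and> norm (f (s, y) w - f (s, y) w') \<le> b s * norm (w - w')"
    and N: "N \<in> null_sets \<mu>"
    and K: "\<And>s y. s \<in> {r..T} - N \<Longrightarrow> u (s, y) \<in> K" "\<And>s y. s \<in> {r..T} - N \<Longrightarrow> v (s, y) \<in> K"
    and t: "t \<le> T"
    and c: "0 \<le> c" "\<And>s y. s \<in> {r..t} - N \<Longrightarrow> norm (u (s, y) - v (s, y)) \<le> c"
    and eq: "\<And>s y. s \<in> {t<..T} \<Longrightarrow> u (s, y) = v (s, y)"
  shows "norm (u (r, x) - v (r, x)) \<le> c * (LINT s:{r..t}|\<mu>. b s)"
proof -
  define h where "h z \<omega> s = indicator {r..T} s *\<^sub>R f (s, X s \<omega>) (z (s, X s \<omega>))"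
    for z :: "real \<times> 's \<Rightarrow> real^'k" and \<omega> s
  define J where "J z \<omega> = (LINT s|\<mu>. h z \<omega> s)" for z \<omega>
  have r: "0 \<le> r" "r \<le> T"
    using I(2,4) by auto
  then have "T \<in> I"
    using I(3) by auto
  have prob: "prob_space (P r x)" and sets_P: "sets (P r x) = sets M"
    using Markov r by (auto simp: consistent_progressive_Markov_def)
  interpret prob_space "P r x"
    by (rule prob)
  have space_P: "space (P r x) = space M"
    by (rule sets_eq_imp_space_eq[OF sets_P])
  have AE_N: "AE s in \<mu>. s \<notin> N"
    by (rule AE_not_in[OF N])
  \<comment> \<open>Off \<open>N\<close> the solution takes values in \<open>K\<close>, so its
    integrand is dominated by \<open>b\<close>. Hence \<open>J u\<close> is bounded by the total
    integral of \<open>b\<close>, uniformly in \<omega>, and is integrable under a probability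
    measure.\<close>
  have J: "u (r, x) = (\<integral>\<omega>. u (T, X T \<omega>) \<partial>P r x) - (\<integral>\<omega>. J u \<omega> \<partial>P r x) \<and> J u \<in> borel_measurable M \<and>
      (\<forall>\<omega>\<in>space M. integrable \<mu> (h u \<omega>)) \<and> integrable (P r x) (J u)"
    if u: "is_solution T dS \<mu> M X P D f g I u" and K: "\<And>s y. s \<in> {r..T} - N \<Longrightarrow> u (s, y) \<in> K" for u
  proof -
    have "u \<in> pm_borel (I \<times> UNIV) dS \<rightarrow>\<^sub>M restrict_space borel D"
      using u by (simp add: is_solution_def)
    from solution_integrand_measurable[OF \<mu> dS Markov f I this]
    have meas: "case_prod (h u) \<in> borel_measurable (M \<Otimes>\<^sub>M \<mu>)"
      by (simp add: h_def[abs_def])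
    have bound: "AE s in \<mu>. norm (h u \<omega> s) \<le> b s" for \<omega>
      using b(3) AE_N AE_space
    proof eventually_elim
      case (elim s)
      show ?case
      proof (cases "s \<in> {r..T}")
        case True
        then have "u (s, X s \<omega>) \<in> K"
          using K elim(2) by simp
        then have "norm (f (s, X s \<omega>) (u (s, X s \<omega>))) \<le> b s"
          using elim(1) by blast
        then show ?thesis
          using True by (simp add: h_def)
      next
        case False
        then show ?thesis
          using b(2)[OF elim(3)] by (simp add: h_def)
      qed
    qed
    have Jm: "J u \<in> borel_measurable M"
      unfolding J_def by (rule borel_measurable_integral_dominated[OF meas b(1,2) bound])
    have hi: "integrable \<mu> (h u \<omega>)" if "\<omega> \<in> space M" for \<omega>
    proof (rule Bochner_Integration.integrable_bound[OF b(1)])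
      show "h u \<omega> \<in> borel_measurable \<mu>"
        using measurable_Pair2[OF meas that] by simp
      show "AE s in \<mu>. norm (h u \<omega> s) \<le> norm (b s)"
        using bound[of \<omega>] by eventually_elim simp
    qed
    have "norm (J u \<omega>) \<le> (LINT s|\<mu>. b s)" if "\<omega> \<in> space M" for \<omega>
      unfolding J_def using hi[OF that] b(1) bound
      by (intro order_trans[OF integral_norm_bound integral_mono_AE]) auto
    then have "integrable (P r x) (J u)"
      using Jm by (intro integrable_const_bound[where B = "LINT s|\<mu>. b s"])
        (auto simp: space_P measurable_cong_sets[OF sets_P refl])
    moreover have "(\<integral>\<omega>. u (T, X T \<omega>) \<partial>P r x) = u (r, x) + (\<integral>\<omega>. J u \<omega> \<partial>P r x)"
      using u I(4) r(2) \<open>T \<in> I\<close> unfolding is_solution_def J_def h_def set_lebesgue_integral_def by blast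
    ultimately show ?thesis
      using Jm hi by simp
  qed
  note Ju = J[OF u K(1)] and Jv = J[OF v K(2)]
  have "u (T, y) = v (T, y)" for y
    using u v by (simp add: is_solution_def)
  then have "u (r, x) - v (r, x) = (\<integral>\<omega>. J v \<omega> \<partial>P r x) - (\<integral>\<omega>. J u \<omega> \<partial>P r x)"
    using Ju Jv by simp
  also have "\<dots> = (\<integral>\<omega>. J v \<omega> - J u \<omega> \<partial>P r x)"
    using Ju Jv by simp
  finally have "norm (u (r, x) - v (r, x)) \<le> (\<integral>\<omega>. norm (J v \<omega> - J u \<omega>) \<partial>P r x)"
    by simp
  also have "\<dots> \<le> (\<integral>\<omega>. c * (LINT s:{r..t}|\<mu>. b s) \<partial>P r x)"
  proof (rule integral_mono)
    show "integrable (P r x) (\<lambda>\<omega>. norm (J v \<omega> - J u \<omega>))"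
      using Ju Jv by (intro integrable_norm Bochner_Integration.integrable_diff) auto
    fix \<omega> assume "\<omega> \<in> space (P r x)"
    then have \<omega>: "\<omega> \<in> space M"
      by (simp add: space_P)
    have hi: "integrable \<mu> (h u \<omega>)" "integrable \<mu> (h v \<omega>)"
      using Ju Jv \<omega> by auto
    have "{r..t} \<in> sets \<mu>"
      using r t unfolding \<mu> by (auto simp: sets_restrict_space intro!: image_eqI[of _ _ "{r..t}"])
    then have bi: "integrable \<mu> (\<lambda>s. c * (indicator {r..t} s *\<^sub>R b s))"
      using b(1) by (intro integrable_mult_right integrable_mult_indicator)
    have "AE s in \<mu>. norm (h v \<omega> s - h u \<omega> s) \<le> c * (indicator {r..t} s *\<^sub>R b s)"
      using b(3) AE_N AE_space
    proof eventually_elim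
      case (elim s)
      have bs: "0 \<le> b s"
        using b(2) elim(3) .
      consider "s \<notin> {r..T}" | "s \<in> {r..T}" "t < s" | "s \<in> {r..T}" "s \<in> {r..t}"
        by fastforce
      then show ?case
      proof cases
        case 3
        have "norm (f (s, X s \<omega>) (v (s, X s \<omega>)) - f (s, X s \<omega>) (u (s, X s \<omega>)))
            \<le> b s * norm (v (s, X s \<omega>) - u (s, X s \<omega>))"
          using elim(1,2) 3 K by blast
        also have "\<dots> \<le> b s * c"
          using c(2)[of s] 3 elim(2) bs by (intro mult_left_mono) (auto simp: norm_minus_commute)
        finally show ?thesis
          using 3 by (simp add: h_def mult.commute)
      qed (use c(1) bs eq[of s] in \<open>auto simp: h_def\<close>)
    qed
    then have "(LINT s|\<mu>. norm (h v \<omega> s - h u \<omega> s)) \<le> (LINT s|\<mu>. c * (indicator {r..t} s *\<^sub>R b s))"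
      using hi bi by (intro integral_mono_AE) auto
    then have "norm (LINT s|\<mu>. h v \<omega> s - h u \<omega> s) \<le> (LINT s|\<mu>. c * (indicator {r..t} s *\<^sub>R b s))"
      by (rule order_trans[OF integral_norm_bound])
    then show "norm (J v \<omega> - J u \<omega>) \<le> c * (LINT s:{r..t}|\<mu>. b s)"
      using hi by (simp add: J_def set_lebesgue_integral_def)
  qed simp
  also have "\<dots> = c * (LINT s:{r..t}|\<mu>. b s)"
    by (simp add: prob_space)
  finally show ?thesis .
qed

section \<open>Uniqueness by continuation to the left\<close>

theorem corollary3p3:
  fixes T :: real
    and dS :: "real \<times> 's::topological_space \<Rightarrow> real \<times> 's \<Rightarrow> real"
    and \<mu> :: "real measure"
    and M :: "'w measure" and F :: "real \<Rightarrow> 'w measure"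
    and X :: "real \<Rightarrow> 'w \<Rightarrow> 's" and P :: "real \<Rightarrow> 's \<Rightarrow> 'w measure"
    and D :: "(real^'k) set"
    and f :: "real \<times> 's \<Rightarrow> real^'k \<Rightarrow> real^'k" and g :: "'s \<Rightarrow> real^'k"
  assumes "separable_space (euclidean :: 's topology)"
    and "metrizable_space (euclidean :: 's topology)"
    and "T > 0"
    and "sets \<mu> = sets (restrict_space borel {0..T})" and "atomless \<mu>"
    and "admissible_pseudometric T dS"
    and "consistent_progressive_Markov T dS M F X P"
    and "D \<in> sets borel" and "interior D \<noteq> {}"
    and "g \<in> borel \<rightarrow>\<^sub>M restrict_space borel D" and "bounded (range g)"
    and "consistent_terminal T dS g"
    and "f \<in> BC1m T dS \<mu> D"
  shows "\<forall>I. admissible_interval T I \<longrightarrow>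
    (\<forall>u v. is_solution T dS \<mu> M X P D f g I u \<and> mu_admissible T \<mu> D I u \<and>
           is_solution T dS \<mu> M X P D f g I v \<and> mu_admissible T \<mu> D I v \<longrightarrow>
           (\<forall>r\<in>I. \<forall>x. u (r, x) = v (r, x)))"
proof (intro allI impI ballI, elim conjE)
  fix I u v r\<^sub>0 x\<^sub>0
  assume adm: "admissible_interval T I"
    and u: "is_solution T dS \<mu> M X P D f g I u" and u': "mu_admissible T \<mu> D I u"
    and v: "is_solution T dS \<mu> M X P D f g I v" and v': "mu_admissible T \<mu> D I v"
    and r0: "r\<^sub>0 \<in> I"
  have I: "I \<in> sets borel" "I \<subseteq> {0..T}" "{r\<^sub>0..T} \<subseteq> I"
    using adm r0 by (auto simp: admissible_interval_def)
  have r0': "0 \<le> r\<^sub>0" "r\<^sub>0 \<le> T"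
    using I r0 by auto
  \<comment> \<open>Admissibility at the fixed time \<open>r\<^sub>0\<close> provides one compact
    set of values for all of \<open>[r\<^sub>0, T]\<close> off a null set. The argument therefore
    stays on this interval, also when \<open>I\<close> is open on the left.\<close>
  obtain Nu where Nu: "Nu \<in> null_sets \<mu>" "compact (closure (u ` (({r\<^sub>0..T} - Nu) \<times> UNIV)))"
    "closure (u ` (({r\<^sub>0..T} - Nu) \<times> UNIV)) \<subseteq> D"
    using u' r0 by (auto simp: mu_admissible_def)
  obtain Nv where Nv: "Nv \<in> null_sets \<mu>" "compact (closure (v ` (({r\<^sub>0..T} - Nv) \<times> UNIV)))"
    "closure (v ` (({r\<^sub>0..T} - Nv) \<times> UNIV)) \<subseteq> D"
    using v' r0 by (auto simp: mu_admissible_def)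
  define K where "K = closure (u ` (({r\<^sub>0..T} - Nu) \<times> UNIV)) \<union> closure (v ` (({r\<^sub>0..T} - Nv) \<times> UNIV))"
  define N where "N = Nu \<union> Nv"
  have N: "N \<in> null_sets \<mu>"
    using Nu(1) Nv(1) by (simp add: N_def null_sets.Un)
  have K: "compact K" "K \<subseteq> D"
    using Nu Nv by (auto simp: K_def)
  have in_K: "u (s, y) \<in> K" "v (s, y) \<in> K" if "s \<in> {r\<^sub>0..T} - N" for s y
  proof -
    have "u (s, y) \<in> u ` (({r\<^sub>0..T} - Nu) \<times> UNIV)" "v (s, y) \<in> v ` (({r\<^sub>0..T} - Nv) \<times> UNIV)"
      using that by (auto simp: N_def)
    then show "u (s, y) \<in> K" "v (s, y) \<in> K"
      unfolding K_def by (auto intro: subsetD[OF closure_subset])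
  qed
  obtain a where a: "\<And>w. w \<in> K \<Longrightarrow> norm w \<le> a" "a > 0"
    using compact_imp_bounded[OF K(1)] by (auto simp: bounded_pos)
  obtain b where b: "integrable \<mu> b" "\<And>s. s \<in> space \<mu> \<Longrightarrow> 0 \<le> b s"
    "AE s in \<mu>. \<forall>y. \<forall>w\<in>K. \<forall>w'\<in>K.
      norm (f (s, y) w) \<le> b s \<and> norm (f (s, y) w - f (s, y) w') \<le> b s * norm (w - w')"
    by (rule BC1m_compact[OF \<open>f \<in> BC1m T dS \<mu> D\<close> \<open>sets \<mu> = _\<close> K]) (rule that)
  have sets_\<mu>: "{r..t} \<in> sets \<mu>" if "r\<^sub>0 \<le> r" "t \<le> T" for r t
    using r0' that unfolding \<open>sets \<mu> = _\<close>
    by (auto simp: sets_restrict_space intro!: image_eqI[of _ _ "{r..t}"])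
  have bound: "norm (u (r, x) - v (r, x)) \<le> c * (LINT s:{r..t}|\<mu>. b s)"
    if "r\<^sub>0 \<le> r" "r \<le> t" "t \<le> T" "\<And>s y. s \<in> {t<..T} \<Longrightarrow> u (s, y) = v (s, y)" "0 \<le> c"
      "\<And>s y. s \<in> {r..t} - N \<Longrightarrow> norm (u (s, y) - v (s, y)) \<le> c" for r t c x
  proof (rule solution_difference_bound[OF \<open>sets \<mu> = _\<close> \<open>admissible_pseudometric T dS\<close>
        \<open>consistent_progressive_Markov T dS M F X P\<close> \<open>f \<in> BC1m T dS \<mu> D\<close> I(1,2) _ _ u v b N])
    show "{r..T} \<subseteq> I" "r \<in> I"
      using that I by auto
  qed (use that in_K in auto)
  \<comment> \<open>One step to the left: the constant 1/2 makes each application of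
    \<open>bound\<close> halve the uniform bound for \<open>u - v\<close>, which therefore tends to
    0.\<close>
  have eq_left: "u (s, y) = v (s, y)"
    if r: "r\<^sub>0 \<le> r" "r \<le> t" "t \<le> T" and eq: "\<And>s y. s \<in> {t<..T} \<Longrightarrow> u (s, y) = v (s, y)"
      and small: "(LINT s:{r..t}|\<mu>. b s) \<le> 1 / 2" and s: "s \<in> {r..t}" for r t s y
  proof -
    have small': "(LINT s:{q..t}|\<mu>. b s) \<le> 1 / 2" if q: "q \<in> {r..t}" for q
    proof -
      have "(LINT s:{q..t}|\<mu>. b s) \<le> (LINT s:{r..t}|\<mu>. b s)"
        unfolding set_lebesgue_integral_def
      proof (rule integral_mono)
        show "integrable \<mu> (\<lambda>s. indicator {q..t} s *\<^sub>R b s)" "integrable \<mu> (\<lambda>s. indicator {r..t} s *\<^sub>R b s)"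
          using q r b(1) by (intro integrable_mult_indicator sets_\<mu>; simp)+
        show "indicator {q..t} s *\<^sub>R b s \<le> indicator {r..t} s *\<^sub>R b s" if "s \<in> space \<mu>" for s
          using b(2)[OF that] q by (auto simp: indicator_def)
      qed
      then show ?thesis
        using small by simp
    qed
    have half: "norm (u (q, y) - v (q, y)) \<le> c / 2"
      if "0 \<le> c" "\<And>s y. s \<in> {r..t} - N \<Longrightarrow> norm (u (s, y) - v (s, y)) \<le> c" "q \<in> {r..t}" for c q y
    proof -
      have "norm (u (q, y) - v (q, y)) \<le> c * (LINT s:{q..t}|\<mu>. b s)"
        using r that by (intro bound eq) auto
      also have "\<dots> \<le> c * (1 / 2)"
        using that small' by (intro mult_left_mono) auto
      finally show ?thesis by simp
    qed
    \<comment> \<open>The start \<open>2 * a\<close> comes from the triangle inequality for two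
      points of \<open>K\<close>, which is why \<open>q\<close> has to avoid
      \<open>N\<close>.\<close>
    have pow: "norm (u (q, y) - v (q, y)) \<le> 2 * a / 2 ^ n" if "q \<in> {r..t} - N" for q y n
      using that
    proof (induction n arbitrary: q y)
      case 0
      then have "q \<in> {r\<^sub>0..T} - N"
        using r by auto
      then have "norm (u (q, y)) \<le> a" "norm (v (q, y)) \<le> a"
        using in_K a(1) by auto
      then show ?case
        using norm_triangle_ineq4[of "u (q, y)" "v (q, y)"] by simp
    next
      case (Suc n)
      then have "norm (u (q, y) - v (q, y)) \<le> 2 * a / 2 ^ n / 2"
        using a(2) by (intro half) auto
      then show ?case
        by (simp add: field_simps)
    qed
    \<comment> \<open>From an estimate off \<open>N\<close>, \<open>half\<close> yields one at every
      time of \<open>[r, t]\<close>. This last use of it covers the given \<open>s\<close>, which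
      may lie in \<open>N\<close>.\<close>
    have "norm (u (s, y) - v (s, y)) \<le> 2 * a / 2 ^ n / 2" for n
      using a(2) s pow by (intro half) auto
    moreover have "(\<lambda>n. 2 * a / 2 ^ n / 2) \<longlonglongrightarrow> 0"
      using tendsto_divide[OF LIMSEQ_divide_realpow_zero[of 2 "2 * a"] tendsto_const[of 2]]
      by (simp del: divide_divide_eq_left)
    ultimately have "norm (u (s, y) - v (s, y)) \<le> 0"
      by (intro LIMSEQ_le_const) auto
    then show ?thesis
      by simp
  qed
  \<comment> \<open>Equality is demanded strictly after \<open>t\<close>. So \<open>T\<close> is in
    \<open>A\<close> vacuously, and the infimum inherits the property, as every \<open>s\<close>
    above it exceeds some member of \<open>A\<close>.\<close>
  define A where "A = {t\<in>{r\<^sub>0..T}. \<forall>s\<in>{t<..T}. \<forall>y. u (s, y) = v (s, y)}"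
  define t where "t = Inf A"
  have "T \<in> A"
    using r0' by (simp add: A_def)
  moreover have bdd: "bdd_below A"
    by (rule bdd_belowI[of _ "r\<^sub>0"]) (auto simp: A_def)
  ultimately have t: "r\<^sub>0 \<le> t" "t \<le> T"
    unfolding t_def by (auto intro!: cInf_greatest cInf_lower simp: A_def)
  have eq: "u (s, y) = v (s, y)" if s: "s \<in> {t<..T}" for s y
  proof -
    obtain q where "q \<in> A" "q < s"
      using s cInf_lessD[of A s] \<open>T \<in> A\<close> unfolding t_def by auto
    then show ?thesis
      using s by (auto simp: A_def)
  qed
  \<comment> \<open>If \<open>t\<close> were larger, the absence of atoms would give some
    \<open>r < t\<close> with small integral over \<open>[r, t]\<close>. Then \<open>eq_left\<close>
    would put \<open>r\<close> into \<open>A\<close>, below its infimum.\<close>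
  have "t = r\<^sub>0"
  proof (rule ccontr)
    assume "t \<noteq> r\<^sub>0"
    then obtain r where r: "r\<^sub>0 \<le> r" "r < t" "(LINT s:{r..t}|\<mu>. b s) \<le> 1 / 2"
      using atomless_small_integral[OF \<open>sets \<mu> = _\<close> \<open>atomless \<mu>\<close> b(1) r0'(1), of t "1 / 2"] t by auto
    have "u (s, y) = v (s, y)" if "s \<in> {r<..T}" for s y
      using eq_left[OF r(1) _ t(2) eq r(3), of s y] eq[of s y] r(2) that by (cases "s \<le> t") auto
    then have "r \<in> A"
      using r t by (simp add: A_def)
    then show False
      using cInf_lower[OF _ bdd] r(2) unfolding t_def by fastforce
  qed
  \<comment> \<open>So far equality holds strictly after \<open>r\<^sub>0\<close>. The time
    \<open>r\<^sub>0\<close> itself is reached by \<open>eq_left\<close> on the degenerate interval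
    \<open>{r\<^sub>0}\<close>, over which the integral vanishes.\<close>
  moreover have "(LINT s:{r\<^sub>0..r\<^sub>0}|\<mu>. b s) \<le> 1 / 2"
    using atomless_integral_singleton[OF \<open>atomless \<mu>\<close>, of "r\<^sub>0" b] sets_\<mu>[of "r\<^sub>0" "r\<^sub>0"] r0' by simp
  ultimately show "u (r\<^sub>0, x\<^sub>0) = v (r\<^sub>0, x\<^sub>0)"
    using eq_left[of r\<^sub>0 r\<^sub>0 r\<^sub>0] eq t by auto
qed

end
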